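(* The realizability problem of TSL is undecidable. That is, there is no algorithm which, given a TSL formula $\varphi$ (together with its finite sets of input, output, cell, function and predicate symbols), decides whether $\varphi$ is realizable, i.e. whether $$\exists\sigma:\mathcal{I}^+\to\mathcal{C}.\ \forall\iota\in\mathcal{I}^\omega.\ \forall\langle\cdot\rangle:\mathbb{F}\to\mathcal{F}.\quad \sigma\wr\iota,\ \iota\vDash_{\langle\cdot\rangle}\varphi.$$
   Context: **Values and functions.** Time is discrete, $t\in\mathbb{N}=\{0,1,2,\dots\}$. $\mathcal{V}$ is the set of all values (objects of arbitrary type; for instance Booleans, numbers and finite words are values), containing the Booleans $\mathcal{B}\subseteq\mathcal{V}$. $\mathcal{F}$ is the set of all functions $\mathcal{V}^n\to\mathcal{V}$ of arbitrary arity $n\ge 0$ (constants are the $0$-ary functions and are identified with values), and $\mathcal{P}\subseteq\mathcal{F}$ is the set of all predicates $\mathcal{V}^n\to\mathcal{B}$. $B^{[A]}$ denotes the set of total functions from $A$ to $B$. **Terms and updates.** A formula is built over finite sets of symbols: inputs $\mathbb{I}$, outputs $\mathbb{O}$, cells $\mathbb{C}$ (a symbol may be both an output and a cell), and sets of function literals $\mathbb{F}$ and predicate literals $\mathbb{P}\subseteq\mathbb{F}$, each literal with an arity. Function terms are generated by $\tau_F ::= s_i \mid f\,\tau_F^0\cdots\tau_F^{n-1}$ with $s_i\in\mathbb{I}\cup\mathbb{C}$ and $f\in\mathbb{F}$ of arity $n$; predicate terms have the form $p\,\tau_F^0\cdots\tau_F^{n-1}$ with $p\in\mathbb{P}$ of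 arity $n$ (in particular predicate terms are function terms). An update is an expression $[s_o\leftarrow\tau_F]$ with $s_o\in\mathbb{O}\cup\mathbb{C}$ and $\tau_F$ a function term. $\equiv$ denotes syntactic equality of terms. An assignment $\langle\cdot\rangle:\mathbb{F}\to\mathcal{F}$ interprets each literal by a function of the same arity, predicate literals being interpreted by predicates. **Computations.** Let $\mathcal{I}=\mathcal{V}^{[\mathbb{I}]}$ be the set of momentary inputs; input streams are $\iota\in\mathcal{I}^\omega$. Let $\mathcal{C}$ be the set of computation steps, i.e. of maps from $\mathbb{O}\cup\mathbb{C}$ to function terms; computations are $\varsigma\in\mathcal{C}^\omega$. For every cell $c\in\mathbb{C}$ there is a predefined initial value $\mathit{init}_c\in\mathcal{V}$. The evaluation function $\eta_{\langle\cdot\rangle}(\varsigma,\iota,t,\tau)\in\mathcal{V}$ is defined by: - $\eta_{\langle\cdot\rangle}(\varsigma,\iota,t,s)=\iota(t)(s)$ if $s\in\mathbb{I}$; - $\eta_{\langle\cdot\rangle}(\varsigma,\iota,0,s)=\mathit{init}_s$ if $s\in\mathbb{C}$; - $\eta_{\langle\cdot\rangle}(\varsigma,\iota,t,s)=\eta_{\langle\cdot\rangle}(\varsigma,\iota,t-1,\varsigma(t-1)(s))$ if $s\in\mathbb{C}$ and $t>0$; - $\eta_{\langle\cdot\rangle}(\varsigma,\iota,t,f\,\tau_0\cdots\tau_{m-1})=\langle f\rangle\,\eta_{\langle\cdot\rangle}(\varsigma,\iota,t,\tau_0)\cdots\eta_{\langle\cdot\rangle}(\varsigma,\iota,t,\tau_{m-1})$.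 **TSL.** Formulas: $\varphi ::= \tau \mid \neg\varphi\mid\varphi\wedge\varphi\mid\mathsf{X}\varphi\mid\varphi\,\mathsf{U}\,\varphi$, where $\tau$ is a predicate term or an update. Satisfaction $\varsigma,\iota,t\vDash_{\langle\cdot\rangle}\varphi$: - for a predicate term $\tau$: iff $\eta_{\langle\cdot\rangle}(\varsigma,\iota,t,\tau)$ is true; - for an update $[s\leftarrow\tau]$: iff $\varsigma(t)(s)\equiv\tau$; - Boolean connectives as usual; $\mathsf{X}\psi$: iff $\varsigma,\iota,t+1\vDash_{\langle\cdot\rangle}\psi$; - $\vartheta\,\mathsf{U}\,\psi$: iff there is $t''\ge t$ with $\varsigma,\iota,t''\vDash_{\langle\cdot\rangle}\psi$ and $\varsigma,\iota,t'\vDash_{\langle\cdot\rangle}\vartheta$ for all $t\le t'<t''$. $\varsigma,\iota\vDash_{\langle\cdot\rangle}\varphi$ means $\varsigma,\iota,0\vDash_{\langle\cdot\rangle}\varphi$. **Branches.** For a strategy $\sigma:\mathcal{I}^+\to\mathcal{C}$ and $\iota\in\mathcal{I}^\omega$, $\sigma\wr\iota\in\mathcal{C}^\omega$ is the computation $(\sigma\wr\iota)(t)=\sigma(\iota(0)\cdots\iota(t))$. *)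

theory Defs
  imports Main "HOL-Library.Nat_Bijection" "HOL-Library.FuncSet"
begin

section \<open>Partial recursive functions and decidability\<close>

datatype recf =
    Zero
  | Succ
  | Proj nat
  | Comp recf "recf list"
  | PRec recf recf
  | Mu recf

text \<open>
  \<open>computes f xs y\<close>: the partial recursive function described by \<open>f\<close> is defined on the
  argument tuple \<open>xs\<close> and has the value \<open>y\<close> there. The recursion variable of \<open>PRec\<close> and the
  search variable of \<open>Mu\<close> are the first arguments. As usual, \<open>Mu f\<close> is
  defined only if \<open>f\<close> is defined at all points below the first zero.
\<close>

inductive computes :: "recf \<Rightarrow> nat list \<Rightarrow> nat \<Rightarrow> bool" where
  zero: "computes Zero xs 0"
| succ: "computes Succ [x] (Suc x)"
| proj: "i < length xs \<Longrightarrow> computes (Proj i) xs (xs ! i)"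
| comp: "list_all2 (\<lambda>g y. computes g xs y) gs ys \<Longrightarrow> computes f ys z \<Longrightarrow>
    computes (Comp f gs) xs z"
| prec_0: "computes f xs y \<Longrightarrow> computes (PRec f g) (0 # xs) y"
| prec_Suc: "computes (PRec f g) (n # xs) y \<Longrightarrow> computes g (n # y # xs) z \<Longrightarrow>
    computes (PRec f g) (Suc n # xs) z"
| mu: "computes f (n # xs) 0 \<Longrightarrow> (\<And>m. m < n \<Longrightarrow> \<exists>y. computes f (m # xs) (Suc y)) \<Longrightarrow>
    computes (Mu f) xs n"

inductive_cases computes_ZeroE: "computes Zero xs y"
inductive_cases computes_SuccE: "computes Succ xs y"
inductive_cases computes_ProjE: "computes (Proj i) xs y"
inductive_cases computes_CompE: "computes (Comp f gs) xs y"
inductive_cases computes_PRec_0E: "computes (PRec f g) (0 # xs) y"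
inductive_cases computes_PRec_SucE: "computes (PRec f g) (Suc n # xs) y"
inductive_cases computes_MuE: "computes (Mu f) xs y"

lemma computes_functional: "computes f xs y \<Longrightarrow> computes f xs z \<Longrightarrow> y = z"
proof (induction arbitrary: z rule: computes.induct)
  case (zero xs)
  then show ?case by (auto elim: computes_ZeroE)
next
  case (succ x)
  then show ?case by (auto elim: computes_SuccE)
next
  case (proj i xs)
  then show ?case by (auto elim: computes_ProjE)
next
  case (comp xs gs ys f v)
  from comp.prems obtain ys' where ys': "list_all2 (\<lambda>g y. computes g xs y) gs ys'"
    and f: "computes f ys' z"
    by (auto elim: computes_CompE)
  have "ys = ys'"
  proof (rule nth_equalityI)
    show "length ys = length ys'"
      using comp.IH(1) ys' by (auto dest!: list_all2_lengthD)
    fix i assume "i < length ys"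
    then show "ys ! i = ys' ! i"
      using comp.IH(1) ys' by (auto simp: list_all2_conv_all_nth)
  qed
  then show ?case using comp.IH(2) f by blast
next
  case (prec_0 f xs y g)
  from prec_0.prems have "computes f xs z" by (rule computes_PRec_0E)
  then show ?case by (rule prec_0.IH)
next
  case (prec_Suc f g n xs y v)
  from prec_Suc.prems obtain y' where y': "computes (PRec f g) (n # xs) y'"
    and z: "computes g (n # y' # xs) z"
    by (rule computes_PRec_SucE)
  have "y = y'" using y' by (rule prec_Suc.IH(1))
  with z show ?case using prec_Suc.IH(2) by simp
next
  case (mu f n xs)
  from mu.prems have z: "computes f (z # xs) 0"
    and below: "m < z \<Longrightarrow> \<exists>y. computes f (m # xs) (Suc y)" for m
    by (rule computes_MuE; blast)+
  have "\<not> z < n"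
  proof
    assume "z < n"
    then obtain y where "\<forall>x. computes f (z # xs) x \<longrightarrow> Suc y = x"
      using mu.IH(2) by blast
    with z show False by blast
  qed
  moreover have "\<not> n < z"
  proof
    assume "n < z"
    then obtain y where "computes f (n # xs) (Suc y)" using below by blast
    with mu.IH(1) show False by blast
  qed
  ultimately show ?case by simp
qed

text \<open>
  A problem consists of a set \<open>X\<close> of instances, coded as natural numbers, and a property \<open>Q\<close>
  of instances. An algorithm deciding it has to terminate with the correct answer on the codes
  of instances; its behaviour on other numbers is irrelevant.
\<close>

definition decidable_problem :: "('a \<Rightarrow> nat) \<Rightarrow> 'a set \<Rightarrow> ('a \<Rightarrow> bool) \<Rightarrow> bool" where
  "decidable_problem code X Q \<longleftrightarrow>
    (\<exists>f. \<forall>x\<in>X. computes f [code x] (if Q x then 1 else 0))"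


section \<open>Syntax of TSL\<close>

type_synonym symbol = nat

text \<open>A literal carries its arity; equal names with different arities are different literals.\<close>

datatype literal = Lit (lit_name: nat) (arity: nat)

record signature =
  Inputs :: "symbol set"
  Outputs :: "symbol set"
  Cells :: "symbol set"
  FunLits :: "literal set"
  PredLits :: "literal set"

definition wf_signature :: "signature \<Rightarrow> bool" where
  "wf_signature S \<longleftrightarrow>
    finite (Inputs S) \<and> finite (Outputs S) \<and> finite (Cells S) \<and> finite (FunLits S) \<and>
    PredLits S \<subseteq> FunLits S \<and> Inputs S \<inter> (Outputs S \<union> Cells S) = {}"

datatype trm = Sym symbol | App literal "trm list"

inductive_set function_terms :: "signature \<Rightarrow> trm set" for S :: signature where
  "s \<in> Inputs S \<union> Cells S \<Longrightarrow> Sym s \<in> function_terms S"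
| "f \<in> FunLits S \<Longrightarrow> length ts = arity f \<Longrightarrow> \<forall>u\<in>set ts. u \<in> function_terms S \<Longrightarrow>
    App f ts \<in> function_terms S"

definition predicate_terms :: "signature \<Rightarrow> trm set" where
  "predicate_terms S =
    {App p ts | p ts. p \<in> PredLits S \<and> length ts = arity p \<and> set ts \<subseteq> function_terms S}"

datatype tsl =
    PredTerm trm
  | Update symbol trm
  | Neg tsl
  | Conj tsl tsl
  | Next tsl
  | Until tsl tsl

fun wf_tsl :: "signature \<Rightarrow> tsl \<Rightarrow> bool" where
  "wf_tsl S (PredTerm u) \<longleftrightarrow> u \<in> predicate_terms S"
| "wf_tsl S (Update s u) \<longleftrightarrow> s \<in> Outputs S \<union> Cells S \<and> u \<in> function_terms S"
| "wf_tsl S (Neg a) \<longleftrightarrow> wf_tsl S a"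
| "wf_tsl S (Conj a b) \<longleftrightarrow> wf_tsl S a \<and> wf_tsl S b"
| "wf_tsl S (Next a) \<longleftrightarrow> wf_tsl S a"
| "wf_tsl S (Until a b) \<longleftrightarrow> wf_tsl S a \<and> wf_tsl S b"

definition tsl_instances :: "(signature \<times> tsl) set" where
  "tsl_instances = {(S, a). wf_signature S \<and> wf_tsl S a}"


section \<open>Semantics of TSL\<close>

text \<open>
  Values are the elements of a type \<open>'v\<close>; the Booleans are contained in it by means of an
  embedding \<open>bl :: bool \<Rightarrow> 'v\<close>. Functions of arity \<open>n\<close> are represented by functions on lists, of
  which only the values on lists of length \<open>n\<close> matter. Momentary inputs and computation steps are
  maps with domain exactly \<open>Inputs S\<close> and \<open>Outputs S \<union> Cells S\<close>; they are represented
  extensionally, so that a strategy sees nothing but the values of the inputs.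
\<close>

type_synonym 'v momentary_input = "symbol \<Rightarrow> 'v"
type_synonym comp_step = "symbol \<Rightarrow> trm"
type_synonym 'v assignment = "literal \<Rightarrow> 'v list \<Rightarrow> 'v"
type_synonym 'v strategy = "'v momentary_input list \<Rightarrow> comp_step"

definition momentary_inputs :: "signature \<Rightarrow> 'v momentary_input set" where
  "momentary_inputs S = (Inputs S \<rightarrow>\<^sub>E UNIV)"

definition comp_steps :: "signature \<Rightarrow> comp_step set" where
  "comp_steps S = (Outputs S \<union> Cells S \<rightarrow>\<^sub>E function_terms S)"

definition assignments :: "(bool \<Rightarrow> 'v) \<Rightarrow> signature \<Rightarrow> 'v assignment set" where
  "assignments bl S =
    {A. \<forall>p\<in>PredLits S. \<forall>vs. length vs = arity p \<longrightarrow> A p vs \<in> range bl}"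

definition strategies :: "signature \<Rightarrow> 'v strategy set" where
  "strategies S = ({xs. xs \<noteq> [] \<and> set xs \<subseteq> momentary_inputs S} \<rightarrow> comp_steps S)"

definition branch :: "'v strategy \<Rightarrow> (nat \<Rightarrow> 'v momentary_input) \<Rightarrow> nat \<Rightarrow> comp_step" where
  "branch \<sigma> \<iota> t = \<sigma> (map \<iota> [0..<Suc t])"

text \<open>
  In the following function, a symbol that is not an input is treated as a cell; other symbols do
  not occur in function terms.
\<close>

function eval :: "signature \<Rightarrow> (symbol \<Rightarrow> 'v) \<Rightarrow> 'v assignment \<Rightarrow> (nat \<Rightarrow> comp_step) \<Rightarrow>
    (nat \<Rightarrow> 'v momentary_input) \<Rightarrow> nat \<Rightarrow> trm \<Rightarrow> 'v" where
  "eval S init A \<zeta> \<iota> t (Sym s) =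
    (if s \<in> Inputs S then \<iota> t s
     else case t of 0 \<Rightarrow> init s | Suc t' \<Rightarrow> eval S init A \<zeta> \<iota> t' (\<zeta> t' s))"
| "eval S init A \<zeta> \<iota> t (App f ts) = A f (map (eval S init A \<zeta> \<iota> t) ts)"
  by pat_completeness auto
termination
  by (relation "(\<lambda>(S, init, A, \<zeta>, \<iota>, t, u). t) <*mlex*> measure (\<lambda>(S, init, A, \<zeta>, \<iota>, t, u). size u)")
    (auto simp: wf_mlex mlex_less mlex_leq less_Suc_eq_le size_list_estimation')

fun sat :: "(bool \<Rightarrow> 'v) \<Rightarrow> signature \<Rightarrow> (symbol \<Rightarrow> 'v) \<Rightarrow> 'v assignment \<Rightarrow> (nat \<Rightarrow> comp_step) \<Rightarrow>
    (nat \<Rightarrow> 'v momentary_input) \<Rightarrow> nat \<Rightarrow> tsl \<Rightarrow> bool" where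
  "sat bl S init A \<zeta> \<iota> t (PredTerm u) \<longleftrightarrow> eval S init A \<zeta> \<iota> t u = bl True"
| "sat bl S init A \<zeta> \<iota> t (Update s u) \<longleftrightarrow> \<zeta> t s = u"
| "sat bl S init A \<zeta> \<iota> t (Neg a) \<longleftrightarrow> \<not> sat bl S init A \<zeta> \<iota> t a"
| "sat bl S init A \<zeta> \<iota> t (Conj a b) \<longleftrightarrow>
    sat bl S init A \<zeta> \<iota> t a \<and> sat bl S init A \<zeta> \<iota> t b"
| "sat bl S init A \<zeta> \<iota> t (Next a) \<longleftrightarrow> sat bl S init A \<zeta> \<iota> (t + 1) a"
| "sat bl S init A \<zeta> \<iota> t (Until a b) \<longleftrightarrow>
    (\<exists>t''\<ge>t. sat bl S init A \<zeta> \<iota> t'' b \<and> (\<forall>t'. t \<le> t' \<and> t' < t'' \<longrightarrow> sat bl S init A \<zeta> \<iota> t' a))"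

definition realizable :: "(bool \<Rightarrow> 'v) \<Rightarrow> (symbol \<Rightarrow> 'v) \<Rightarrow> signature \<times> tsl \<Rightarrow> bool" where
  "realizable bl init = (\<lambda>(S, a).
    \<exists>\<sigma>\<in>strategies S. \<forall>\<iota>. (\<forall>t. \<iota> t \<in> momentary_inputs S) \<longrightarrow>
      (\<forall>A\<in>assignments bl S. sat bl S init A (branch \<sigma> \<iota>) \<iota> 0 a))"


section \<open>Coding of instances as natural numbers\<close>

fun code_literal :: "literal \<Rightarrow> nat" where
  "code_literal (Lit n k) = prod_encode (n, k)"

fun code_trm :: "trm \<Rightarrow> nat" where
  "code_trm (Sym s) = prod_encode (0, s)"
| "code_trm (App f ts) =
    prod_encode (1, prod_encode (code_literal f, list_encode (map code_trm ts)))"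

fun code_tsl :: "tsl \<Rightarrow> nat" where
  "code_tsl (PredTerm u) = prod_encode (0, code_trm u)"
| "code_tsl (Update s u) = prod_encode (1, prod_encode (s, code_trm u))"
| "code_tsl (Neg a) = prod_encode (2, code_tsl a)"
| "code_tsl (Conj a b) = prod_encode (3, prod_encode (code_tsl a, code_tsl b))"
| "code_tsl (Next a) = prod_encode (4, code_tsl a)"
| "code_tsl (Until a b) = prod_encode (5, prod_encode (code_tsl a, code_tsl b))"

definition code_signature :: "signature \<Rightarrow> nat" where
  "code_signature S = list_encode
    [set_encode (Inputs S), set_encode (Outputs S), set_encode (Cells S),
     set_encode (code_literal ` FunLits S), set_encode (code_literal ` PredLits S)]"

definition code_instance :: "signature \<times> tsl \<Rightarrow> nat" where
  "code_instance = (\<lambda>(S, a). prod_encode (code_signature S, code_tsl a))"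

lemma code_literal_inject [simp]: "code_literal f = code_literal g \<longleftrightarrow> f = g"
  by (cases f; cases g) simp

lemma code_trm_inject [simp]: "code_trm u = code_trm v \<longleftrightarrow> u = v"
proof
  show "code_trm u = code_trm v \<Longrightarrow> u = v"
  proof (induction u arbitrary: v)
    case (Sym s)
    then show ?case by (cases v) auto
  next
    case (App f ts)
    then obtain us where v: "v = App f us" and eq: "map code_trm ts = map code_trm us"
      by (cases v) (auto simp: list_encode_eq)
    have "ts = us"
      using eq App.IH by (metis list.inj_map_strong)
    with v show ?case by simp
  qed
qed simp

lemma code_tsl_inject [simp]: "code_tsl a = code_tsl b \<longleftrightarrow> a = b"
proof
  show "code_tsl a = code_tsl b \<Longrightarrow> a = b"
    by (induction a arbitrary: b; case_tac b) auto
qed simp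

lemma inj_on_code_instance: "inj_on code_instance tsl_instances"
proof (rule inj_onI)
  fix x y
  assume "x \<in> tsl_instances" "y \<in> tsl_instances" and eq: "code_instance x = code_instance y"
  then obtain S a S' a' where xy: "x = (S, a)" "y = (S', a')"
    and fin: "wf_signature S" "wf_signature S'"
    by (auto simp: tsl_instances_def)
  have [simp]: "finite (PredLits S)" "finite (PredLits S')"
    using fin by (auto simp: wf_signature_def intro: finite_subset)
  have inj: "inj code_literal"
    by (simp add: inj_on_def)
  show "x = y"
    using eq fin
    by (auto simp: xy code_instance_def code_signature_def list_encode_eq wf_signature_def
        set_encode_eq inj_image_eq_iff [OF inj])
qed

end

theory Submission
  imports Defs "HOL-Library.Countable"
begin

text \<open>
  The relation \<open>computes\<close> is the least model of finitely many Horn clauses. A TSL formula without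
  inputs can claim that some instance of these clauses fails, or that the program \<open>f\<close> yields 0 on
  \<open>n\<close>; the variables of the clauses are cells. A strategy may update the cells by arbitrary terms,
  hence go through all closed instances. If \<open>f\<close> yields 0 on \<open>n\<close>, this makes the formula true under
  every assignment; otherwise an assignment with the standard meaning of the literals refutes it,
  whatever the strategy does. So realizability of the formula is equivalent to \<open>f\<close> yielding 0 on \<open>n\<close>.

  Programs occur in the formula as terms. With the code of this term as the number of the program, the
  code of the formula for \<open>f\<close> and its own number is a computable function of that number, and
  composing this function with a decision procedure, which answers 0 on unrealizable instances, gives
  a program that yields 0 on its own number if and only if it does not.
\<close>

section \<open>Horn clauses for the evaluation of programs\<close>

abbreviation null_t :: trm where "null_t \<equiv> App (Lit 0 0) []"
abbreviation suc_t :: "trm \<Rightarrow> trm" where "suc_t u \<equiv> App (Lit 1 1) [u]"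
abbreviation cons_t :: "trm \<Rightarrow> trm \<Rightarrow> trm" where "cons_t u v \<equiv> App (Lit 2 2) [u, v]"
abbreviation Succ_t :: trm where "Succ_t \<equiv> App (Lit 3 0) []"
abbreviation Proj_t :: "trm \<Rightarrow> trm" where "Proj_t u \<equiv> App (Lit 4 1) [u]"
abbreviation Comp_t :: "trm \<Rightarrow> trm \<Rightarrow> trm" where "Comp_t u v \<equiv> App (Lit 5 2) [u, v]"
abbreviation PRec_t :: "trm \<Rightarrow> trm \<Rightarrow> trm" where "PRec_t u v \<equiv> App (Lit 6 2) [u, v]"
abbreviation Mu_t :: "trm \<Rightarrow> trm" where "Mu_t u \<equiv> App (Lit 7 1) [u]"

text \<open>Intended readings of the auxiliaries: \<open>nth_t i xs x\<close> for
  \<open>xs ! i = x\<close> with \<open>i\<close> in range, \<open>all2_t gs xs ys\<close> for the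
  programs \<open>gs\<close> yielding the entries of \<open>ys\<close> on \<open>xs\<close>, and
  \<open>below_t f k xs\<close> for positive values of \<open>f\<close> on \<open>m # xs\<close> for
  all \<open>m < k\<close>.\<close>

abbreviation computes_t :: "trm \<Rightarrow> trm \<Rightarrow> trm \<Rightarrow> trm"
  where "computes_t u v w \<equiv> App (Lit 8 3) [u, v, w]"
abbreviation nth_t :: "trm \<Rightarrow> trm \<Rightarrow> trm \<Rightarrow> trm"
  where "nth_t u v w \<equiv> App (Lit 9 3) [u, v, w]"
abbreviation all2_t :: "trm \<Rightarrow> trm \<Rightarrow> trm \<Rightarrow> trm"
  where "all2_t u v w \<equiv> App (Lit 10 3) [u, v, w]"
abbreviation below_t :: "trm \<Rightarrow> trm \<Rightarrow> trm \<Rightarrow> trm"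
  where "below_t u v w \<equiv> App (Lit 11 3) [u, v, w]"

text \<open>
  The constant \<open>null_t\<close> stands for the number 0, for the empty list and for the program
  \<open>Zero\<close>. This is harmless since the position of a term determines how it
  is read.
\<close>

fun nat_trm :: "nat \<Rightarrow> trm" where
  "nat_trm 0 = null_t"
| "nat_trm (Suc n) = suc_t (nat_trm n)"

fun list_trm :: "trm list \<Rightarrow> trm" where
  "list_trm [] = null_t"
| "list_trm (u # us) = cons_t u (list_trm us)"

fun recf_trm :: "recf \<Rightarrow> trm" where
  "recf_trm Zero = null_t"
| "recf_trm Succ = Succ_t"
| "recf_trm (Proj i) = Proj_t (nat_trm i)"
| "recf_trm (Comp f gs) = Comp_t (recf_trm f) (list_trm (map recf_trm gs))"
| "recf_trm (PRec f g) = PRec_t (recf_trm f) (recf_trm g)"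
| "recf_trm (Mu f) = Mu_t (recf_trm f)"

text \<open>The cells are a parameter because \<open>function_terms (sig {})\<close> then consists
  of the closed terms. Without inputs, the history tells a strategy nothing but the time.\<close>

definition sig :: "symbol set \<Rightarrow> signature" where
  "sig C = \<lparr>Inputs = {}, Outputs = {}, Cells = C,
    FunLits = {Lit 0 0, Lit 1 1, Lit 2 2, Lit 3 0, Lit 4 1, Lit 5 2, Lit 6 2, Lit 7 1,
      Lit 8 3, Lit 9 3, Lit 10 3, Lit 11 3},
    PredLits = {Lit 8 3, Lit 9 3, Lit 10 3, Lit 11 3}\<rparr>"

text \<open>The premises of \<open>computes\<close> about list access, \<open>list_all2\<close> and
  all \<open>m < n\<close> are not atoms; recursively described auxiliary predicates replace
  them.\<close>

definition clauses :: "(trm list \<times> trm) list" where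
  "clauses = (let a = Sym 0; b = Sym 1; c = Sym 2; d = Sym 3; e = Sym 4; f = Sym 5 in
    [([], computes_t null_t a null_t),
     ([], computes_t Succ_t (cons_t a null_t) (suc_t a)),
     ([nth_t a b c], computes_t (Proj_t a) b c),
     ([], nth_t null_t (cons_t a b) a),
     ([nth_t a b c], nth_t (suc_t a) (cons_t d b) c),
     ([all2_t b c d, computes_t a d e], computes_t (Comp_t a b) c e),
     ([], all2_t null_t a null_t),
     ([computes_t a c d, all2_t b c e], all2_t (cons_t a b) c (cons_t d e)),
     ([computes_t a c d], computes_t (PRec_t a b) (cons_t null_t c) d),
     ([computes_t (PRec_t a b) (cons_t c d) e, computes_t b (cons_t c (cons_t e d)) f],
        computes_t (PRec_t a b) (cons_t (suc_t c) d) f),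
     ([], below_t a null_t b),
     ([below_t a b c, computes_t a (cons_t b c) (suc_t d)], below_t a (suc_t b) c),
     ([below_t a b c, computes_t a (cons_t b c) null_t], computes_t (Mu_t a) c b)])"

definition top_tsl :: tsl where
  "top_tsl = Neg (Conj (Update 0 null_t) (Neg (Update 0 null_t)))"

fun conj_tsl :: "tsl list \<Rightarrow> tsl" where
  "conj_tsl [] = top_tsl"
| "conj_tsl (a # as) = Conj a (conj_tsl as)"

fun clause_tsl :: "trm list \<times> trm \<Rightarrow> tsl" where
  "clause_tsl (bs, h) = Neg (Conj (conj_tsl (map PredTerm bs)) (Neg (PredTerm h)))"

definition query :: "trm \<Rightarrow> nat \<Rightarrow> trm" where
  "query u n = computes_t u (cons_t (nat_trm n) null_t) null_t"

definition refutation :: "trm \<Rightarrow> nat \<Rightarrow> tsl" where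
  "refutation u n =
    Until top_tsl (Neg (Conj (conj_tsl (map clause_tsl clauses)) (Neg (PredTerm (query u n)))))"

abbreviation horn_sig :: signature where "horn_sig \<equiv> sig {..<6}"

section \<open>Well-formedness of the formula\<close>

lemma Inputs_sig [simp]: "Inputs (sig C) = {}"
  and Outputs_sig [simp]: "Outputs (sig C) = {}"
  and Cells_sig [simp]: "Cells (sig C) = C"
  by (simp_all add: sig_def)

lemma function_terms_Sym_iff: "Sym s \<in> function_terms (sig C) \<longleftrightarrow> s \<in> C"
  by (subst function_terms.simps) auto

lemma function_terms_App_iff:
  "App f us \<in> function_terms S \<longleftrightarrow>
    f \<in> FunLits S \<and> length us = arity f \<and> set us \<subseteq> function_terms S"
  by (subst function_terms.simps) auto

lemma function_terms_sig_mono: "C \<subseteq> D \<Longrightarrow> function_terms (sig C) \<subseteq> function_terms (sig D)"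
proof
  fix u assume "u \<in> function_terms (sig C)" and "C \<subseteq> D"
  then show "u \<in> function_terms (sig D)"
    by induction (auto simp: function_terms_Sym_iff function_terms_App_iff, auto simp: sig_def)
qed

lemma nat_trm_function_term: "nat_trm n \<in> function_terms (sig C)"
  by (induction n) (simp_all add: function_terms_App_iff, simp_all add: sig_def)

lemma list_trm_function_term:
  "set us \<subseteq> function_terms (sig C) \<Longrightarrow> list_trm us \<in> function_terms (sig C)"
  by (induction us) (simp_all add: function_terms_App_iff, simp_all add: sig_def)

lemma recf_trm_function_term: "recf_trm f \<in> function_terms (sig C)"
proof (induction f)
  case (Comp f gs)
  then have "list_trm (map recf_trm gs) \<in> function_terms (sig C)"
    by (intro list_trm_function_term) auto
  with Comp show ?case by (simp add: function_terms_App_iff) (simp add: sig_def)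
qed (simp_all add: function_terms_App_iff nat_trm_function_term, simp_all add: sig_def)

lemma wf_conj_tsl:
  "wf_tsl horn_sig (conj_tsl as) \<longleftrightarrow> (\<forall>a\<in>set as. wf_tsl horn_sig a)"
  by (induction as) (simp_all add: top_tsl_def function_terms_App_iff, simp add: sig_def)

lemma wf_clauses: "c \<in> set clauses \<Longrightarrow> wf_tsl horn_sig (clause_tsl c)"
proof -
  have "\<forall>c\<in>set clauses. \<forall>u\<in>insert (snd c) (set (fst c)). u \<in> predicate_terms horn_sig"
    by (simp add: clauses_def Let_def predicate_terms_def function_terms_App_iff
        function_terms_Sym_iff) (simp add: sig_def)
  then show "c \<in> set clauses \<Longrightarrow> wf_tsl horn_sig (clause_tsl c)"
    by (cases c) (auto simp: wf_conj_tsl)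
qed

lemma refutation_instance: "(horn_sig, refutation (recf_trm f) n) \<in> tsl_instances"
proof -
  have "query (recf_trm f) n \<in> predicate_terms horn_sig"
    by (simp add: query_def predicate_terms_def function_terms_App_iff
        recf_trm_function_term nat_trm_function_term) (simp add: sig_def)
  moreover have "wf_signature horn_sig"
    by (auto simp: wf_signature_def sig_def)
  moreover have "wf_tsl horn_sig top_tsl"
    using wf_conj_tsl [of "[]"] by simp
  ultimately show ?thesis
    by (auto simp: tsl_instances_def refutation_def wf_conj_tsl wf_clauses)
qed


section \<open>Realizability of the refutation formula\<close>

fun tval :: "'v assignment \<Rightarrow> (symbol \<Rightarrow> 'v) \<Rightarrow> trm \<Rightarrow> 'v" where
  "tval A \<rho> (Sym s) = \<rho> s"
| "tval A \<rho> (App f us) = A f (map (tval A \<rho>) us)"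

text \<open>Within one instant, computation and inputs enter only through the values of the symbols.
  This separates the meaning of terms from the passage of time.\<close>

lemma eval_eq_tval:
  "eval S init A \<zeta> \<iota> t u = tval A (\<lambda>s. eval S init A \<zeta> \<iota> t (Sym s)) u"
  by (induction u) (simp_all cong: map_cong)

lemma tval_closed: "u \<in> function_terms (sig {}) \<Longrightarrow> tval A \<rho> u = tval A \<rho>' u"
  by (induction rule: function_terms.induct) (auto cong: map_cong)

definition holds :: "(bool \<Rightarrow> 'v) \<Rightarrow> 'v assignment \<Rightarrow> (symbol \<Rightarrow> 'v) \<Rightarrow> trm list \<times> trm \<Rightarrow> bool" where
  "holds bl A \<rho> c \<longleftrightarrow>
    ((\<forall>b\<in>set (fst c). tval A \<rho> b = bl True) \<longrightarrow> tval A \<rho> (snd c) = bl True)"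

lemma sat_top_tsl [simp]: "sat bl S init A \<zeta> \<iota> t top_tsl"
  by (simp add: top_tsl_def)

lemma sat_conj_tsl:
  "sat bl S init A \<zeta> \<iota> t (conj_tsl as) \<longleftrightarrow> (\<forall>a\<in>set as. sat bl S init A \<zeta> \<iota> t a)"
  by (induction as) auto

lemma sat_clause_tsl:
  "sat bl S init A \<zeta> \<iota> t (clause_tsl c) \<longleftrightarrow>
    holds bl A (\<lambda>s. eval S init A \<zeta> \<iota> t (Sym s)) c"
  by (cases c) (auto simp: sat_conj_tsl holds_def simp flip: eval_eq_tval simp del: eval.simps)

lemma sat_refutation:
  "sat bl S init A \<zeta> \<iota> 0 (refutation u n) \<longleftrightarrow>
    (\<exists>t. (\<exists>c\<in>set clauses. \<not> holds bl A (\<lambda>s. eval S init A \<zeta> \<iota> t (Sym s)) c) \<or>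
      eval S init A \<zeta> \<iota> t (query u n) = bl True)"
  by (auto simp: refutation_def sat_conj_tsl sat_clause_tsl)

section \<open>Derivations from closed instances of the clauses\<close>

text \<open>Induction over \<open>computes\<close>: each rule is simulated by clauses instantiated
  with closed terms. The literals may mean anything, since the derivation runs on terms and distinct
  terms may share a value.\<close>

lemma computes_derivable:
  fixes A :: "'v assignment"
  assumes A: "\<And>us c. length us = 6 \<Longrightarrow> set us \<subseteq> function_terms (sig {}) \<Longrightarrow> c \<in> set clauses \<Longrightarrow>
      holds bl A ((!) (map (tval A \<rho>) us)) c"
    and "computes f xs y"
  shows "tval A \<rho> (computes_t (recf_trm f) (list_trm (map nat_trm xs)) (nat_trm y)) = bl True"
proof -
  let ?T = "function_terms (sig {})"
  define D where "D u \<longleftrightarrow> tval A \<rho> u = bl True" for u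
  define nums where "nums xs = list_trm (map nat_trm xs)" for xs
  define progs where "progs gs = list_trm (map recf_trm gs)" for gs
  have nums_simps [simp]: "nums [] = null_t" "nums (x # xs) = cons_t (nat_trm x) (nums xs)" for x xs
    by (simp_all add: nums_def)
  have progs_simps [simp]: "progs [] = null_t" "progs (g # gs) = cons_t (recf_trm g) (progs gs)" for g gs
    by (simp_all add: progs_def)
  have T [simp]: "null_t \<in> ?T" "nat_trm x \<in> ?T" "recf_trm g \<in> ?T" "nums xs \<in> ?T" "progs gs \<in> ?T"
    for x g xs gs
    using nat_trm_function_term [of 0]
    by (auto simp: nat_trm_function_term recf_trm_function_term nums_def progs_def
        intro!: list_trm_function_term)
  \<comment> \<open>Six closed terms determine an instance of every clause at once; variables that
    do not occur in the clause at hand are filled with \<open>null_t\<close> below.\<close>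
  have "\<forall>r\<in>set clauses. holds bl A ((!) (map (tval A \<rho>) [a, b, c, d, e, f])) r"
    if "{a, b, c, d, e, f} \<subseteq> ?T" for a b c d e f
    using that A [of "[a, b, c, d, e, f]"] by auto
  note clause = this [unfolded clauses_def Let_def holds_def, simplified]
  have D_zero: "D (computes_t null_t a null_t)" if "a \<in> ?T" for a
    using clause [of a null_t null_t null_t null_t null_t] that by (simp add: D_def)
  have D_succ: "D (computes_t Succ_t (cons_t a null_t) (suc_t a))" if "a \<in> ?T" for a
    using clause [of a null_t null_t null_t null_t null_t] that by (simp add: D_def)
  have D_proj: "D (computes_t (Proj_t a) b c)" if "D (nth_t a b c)" "{a, b, c} \<subseteq> ?T" for a b c
    using clause [of a b c null_t null_t null_t] that by (simp add: D_def)
  have D_nth_0: "D (nth_t null_t (cons_t a b) a)" if "{a, b} \<subseteq> ?T" for a b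
    using clause [of a b null_t null_t null_t null_t] that by (simp add: D_def)
  have D_nth_suc: "D (nth_t (suc_t a) (cons_t d b) c)" if "D (nth_t a b c)" "{a, b, c, d} \<subseteq> ?T" for a b c d
    using clause [of a b c d null_t null_t] that by (simp add: D_def)
  have D_comp: "D (computes_t (Comp_t a b) c e)"
    if "D (all2_t b c d)" "D (computes_t a d e)" "{a, b, c, d, e} \<subseteq> ?T" for a b c d e
    using clause [of a b c d e null_t] that by (simp add: D_def)
  have D_all2_Nil: "D (all2_t null_t a null_t)" if "a \<in> ?T" for a
    using clause [of a null_t null_t null_t null_t null_t] that by (simp add: D_def)
  have D_all2_Cons: "D (all2_t (cons_t a b) c (cons_t d e))"
    if "D (computes_t a c d)" "D (all2_t b c e)" "{a, b, c, d, e} \<subseteq> ?T" for a b c d e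
    using clause [of a b c d e null_t] that by (simp add: D_def)
  have D_prec_0: "D (computes_t (PRec_t a b) (cons_t null_t c) d)"
    if "D (computes_t a c d)" "{a, b, c, d} \<subseteq> ?T" for a b c d
    using clause [of a b c d null_t null_t] that by (simp add: D_def)
  have D_prec_Suc: "D (computes_t (PRec_t a b) (cons_t (suc_t c) d) f)"
    if "D (computes_t (PRec_t a b) (cons_t c d) e)" "D (computes_t b (cons_t c (cons_t e d)) f)"
      "{a, b, c, d, e, f} \<subseteq> ?T" for a b c d e f
    using clause [of a b c d e f] that by (simp add: D_def)
  have D_below_0: "D (below_t a null_t b)" if "{a, b} \<subseteq> ?T" for a b
    using clause [of a b null_t null_t null_t null_t] that by (simp add: D_def)
  have D_below_suc: "D (below_t a (suc_t b) c)"
    if "D (below_t a b c)" "D (computes_t a (cons_t b c) (suc_t d))" "{a, b, c, d} \<subseteq> ?T" for a b c d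
    using clause [of a b c d null_t null_t] that by (simp add: D_def)
  have D_mu: "D (computes_t (Mu_t a) c b)"
    if "D (below_t a b c)" "D (computes_t a (cons_t b c) null_t)" "{a, b, c} \<subseteq> ?T" for a b c
    using clause [of a b c null_t null_t null_t] that by (simp add: D_def)
  have D_nth: "i < length xs \<Longrightarrow> D (nth_t (nat_trm i) (nums xs) (nat_trm (xs ! i)))" for i xs
  proof (induction xs arbitrary: i)
    case (Cons x xs)
    then show ?case by (cases i) (auto intro: D_nth_0 D_nth_suc simp del: One_nat_def)
  qed simp
  have "D (computes_t (recf_trm f) (nums xs) (nat_trm y))"
    using assms(2)
  proof (induction rule: computes.induct)
    case (comp xs gs ys f z)
    have "D (all2_t (progs gs) (nums xs) (nums ys))"
      using comp.IH(1) by (induction gs ys rule: list_all2_induct) (auto intro: D_all2_Nil D_all2_Cons)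
    then show ?case
      using D_comp comp.IH(2)
      by (simp flip: progs_def)
  next
    case (prec_0 f xs y g)
    then show ?case
      by (simp add: D_prec_0)
  next
    case (prec_Suc f g n xs y z)
    then show ?case
      using D_prec_Suc [of "recf_trm f" "recf_trm g" "nat_trm n" "nums xs" "nat_trm y" "nat_trm z"] by simp
  next
    case (mu f n xs)
    \<comment> \<open>The universally quantified premise of \<open>Mu\<close> becomes a chain of
      \<open>below_t\<close> facts climbing from 0 to \<open>n\<close>.\<close>
    have "k \<le> n \<Longrightarrow> D (below_t (recf_trm f) (nat_trm k) (nums xs))" for k
    proof (induction k)
      case (Suc k)
      then obtain y where "D (computes_t (recf_trm f) (nums (k # xs)) (nat_trm (Suc y)))"
        using mu.IH(2) [of k] by auto
      with Suc show ?case
        by (auto intro: D_below_suc [where d = "nat_trm y"] simp del: One_nat_def)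
    qed (simp add: D_below_0)
    from this [of n] show ?case
      using D_mu mu.IH(1) by simp
  qed (auto intro: D_zero D_succ D_proj D_nth simp del: One_nat_def)
  then show ?thesis
    by (simp add: D_def nums_def)
qed

section \<open>A strategy that runs through all instances\<close>

text \<open>The time itself codes the tuple of updates. Since \<open>inv code_trm\<close> is
  arbitrary on numbers that code no term, and the list may be too short, a test with default
  \<open>null_t\<close> ensures a legal computation step.\<close>

definition enumeration :: "nat \<Rightarrow> comp_step" where
  "enumeration t = (\<lambda>s\<in>{..<6}.
    let us = map (inv code_trm) (list_decode t) in
      if s < length us \<and> us ! s \<in> function_terms horn_sig then us ! s else null_t)"

lemma enumeration_comp_step: "enumeration t \<in> comp_steps horn_sig"
  using nat_trm_function_term [of 0 "{..<6}"]
  by (auto simp: enumeration_def comp_steps_def Let_def)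

lemma enumeration_complete:
  assumes "length us = 6" and "set us \<subseteq> function_terms horn_sig"
  shows "\<exists>t. \<forall>s<6. enumeration t s = us ! s"
proof -
  have "inv code_trm \<circ> code_trm = id"
    by (intro inv_o_cancel) (simp add: inj_on_def)
  then have "enumeration (list_encode (map code_trm us)) s = us ! s" if "s < 6" for s
    using that assms by (auto simp: enumeration_def Let_def subset_iff)
  then show ?thesis by blast
qed

text \<open>The clauses contain no symbols beyond the six cells, so it is irrelevant what
  \<open>(!)\<close> returns past the end of a list of six values.\<close>

lemma holds_clause_cong:
  assumes "c \<in> set clauses" and "\<And>s. s < 6 \<Longrightarrow> \<rho> s = \<rho>' s"
  shows "holds bl A \<rho> c \<longleftrightarrow> holds bl A \<rho>' c"
  using assms by (auto simp: clauses_def Let_def holds_def)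

text \<open>If the formula failed, all clauses would hold at all times. Every closed instance is
  written into the cells at some time, so all closed instances would hold and yield the
  query.\<close>

lemma realizable_refutation:
  fixes bl :: "bool \<Rightarrow> 'v"
  assumes "computes f [n] 0"
  shows "realizable bl init (horn_sig, refutation (recf_trm f) n)"
proof -
  \<comment> \<open>The history at time \<open>t\<close> has length \<open>t + 1\<close>.\<close>
  define \<sigma> :: "'v strategy" where "\<sigma> xs = enumeration (length xs - 1)" for xs
  have \<sigma>: "\<sigma> \<in> strategies horn_sig"
    by (simp add: strategies_def \<sigma>_def enumeration_comp_step)
  have branch: "branch \<sigma> \<iota> = enumeration" for \<iota>
    by (simp add: branch_def \<sigma>_def fun_eq_iff)
  have "sat bl horn_sig init A enumeration \<iota> 0 (refutation (recf_trm f) n)" for A \<iota>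
  proof (rule ccontr)
    define \<rho> where "\<rho> t s = eval horn_sig init A enumeration \<iota> t (Sym s)" for t s
    assume "\<not> ?thesis"
    then have all: "\<And>t c. c \<in> set clauses \<Longrightarrow> holds bl A (\<rho> t) c"
      and no: "eval horn_sig init A enumeration \<iota> 0 (query (recf_trm f) n) \<noteq> bl True"
      unfolding sat_refutation \<rho>_def by blast+
    have "holds bl A ((!) (map (tval A (\<rho> 0)) us)) c"
      if us: "length us = 6" "set us \<subseteq> function_terms (sig {})" and c: "c \<in> set clauses" for us c
    proof -
      have "set us \<subseteq> function_terms horn_sig"
        using us(2) function_terms_sig_mono by blast
      with us(1) obtain t where t: "\<And>s. s < 6 \<Longrightarrow> enumeration t s = us ! s"
        using enumeration_complete by blast
      \<comment> \<open>Updates made at time \<open>t\<close> show in the cells at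
        \<open>Suc t\<close>; being closed, the terms have the same value at time 0.\<close>
      have "\<rho> (Suc t) s = map (tval A (\<rho> 0)) us ! s" if "s < 6" for s
      proof -
        have "\<rho> (Suc t) s = eval horn_sig init A enumeration \<iota> t (us ! s)"
          by (simp add: \<rho>_def t that)
        also have "\<dots> = tval A (\<rho> t) (us ! s)"
          unfolding \<rho>_def by (rule eval_eq_tval)
        also have "\<dots> = tval A (\<rho> 0) (us ! s)"
          using us that by (intro tval_closed) (auto simp: subset_iff)
        finally show ?thesis using us that by simp
      qed
      then show ?thesis
        using all [OF c, of "Suc t"] holds_clause_cong [OF c] by blast
    qed
    from computes_derivable [OF this assms] have "tval A (\<rho> 0) (query (recf_trm f) n) = bl True"
      by (simp add: query_def)
    with no show False
      unfolding \<rho>_def by (simp only: eval_eq_tval [symmetric] simp_thms)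
  qed
  with \<sigma> show ?thesis
    unfolding realizable_def prod.case by (intro bexI [of _ \<sigma>]) (simp_all add: branch)
qed

section \<open>The standard interpretation\<close>

text \<open>This makes \<open>standard_value\<close> countable, so that it embeds into every
  infinite type of values.\<close>

instance recf :: countable
  by countable_datatype

text \<open>The components of a standard value are its readings as a number, as a list of numbers, as a
  program and as a list of programs.\<close>

type_synonym standard_value = "nat \<times> nat list \<times> recf \<times> recf list"

abbreviation num_of :: "standard_value \<Rightarrow> nat" where "num_of x \<equiv> fst x"
abbreviation nums_of :: "standard_value \<Rightarrow> nat list" where "nums_of x \<equiv> fst (snd x)"
abbreviation prog_of :: "standard_value \<Rightarrow> recf" where "prog_of x \<equiv> fst (snd (snd x))"
abbreviation progs_of :: "standard_value \<Rightarrow> recf list" where "progs_of x \<equiv> snd (snd (snd x))"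

text \<open>The defaults 0, \<open>[]\<close> and \<open>Zero\<close> are the readings of
  \<open>null_t\<close>; they also serve where a literal has no sensible reading of the given
  kind.\<close>

definition standard_fun :: "nat \<Rightarrow> standard_value list \<Rightarrow> standard_value" where
  "standard_fun k xs =
    (if k = 1 then Suc (num_of (xs ! 0)) else 0,
     if k = 2 then num_of (xs ! 0) # nums_of (xs ! 1) else [],
     if k = 3 then Succ
     else if k = 4 then Proj (num_of (xs ! 0))
     else if k = 5 then Comp (prog_of (xs ! 0)) (progs_of (xs ! 1))
     else if k = 6 then PRec (prog_of (xs ! 0)) (prog_of (xs ! 1))
     else if k = 7 then Mu (prog_of (xs ! 0))
     else Zero,
     if k = 2 then prog_of (xs ! 0) # progs_of (xs ! 1) else [])"

definition standard_pred :: "nat \<Rightarrow> standard_value list \<Rightarrow> bool" where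
  "standard_pred k xs =
    (let x = xs ! 0; y = xs ! 1; z = xs ! 2 in
      if k = 8 then computes (prog_of x) (nums_of y) (num_of z)
      else if k = 9 then num_of x < length (nums_of y) \<and> nums_of y ! num_of x = num_of z
      else if k = 10 then list_all2 (\<lambda>g. computes g (nums_of y)) (progs_of x) (nums_of z)
      else \<forall>m<num_of y. \<exists>v. computes (prog_of x) (m # nums_of z) (Suc v))"

lemma computes_Proj: "i < length xs \<Longrightarrow> y = xs ! i \<Longrightarrow> computes (Proj i) xs y"
  using computes.proj by simp

text \<open>Under the standard interpretation the clauses hold for all contents of the cells, so no
  strategy can violate one, and the query has its true meaning.\<close>

lemma unrealizable_refutation:
  fixes bl :: "bool \<Rightarrow> 'v"
  assumes "inj bl" and "infinite (UNIV :: 'v set)" and "\<not> computes f [n] 0"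
  shows "\<not> realizable bl init (horn_sig, refutation (recf_trm f) n)"
proof
  assume "realizable bl init (horn_sig, refutation (recf_trm f) n)"
  then obtain \<sigma> :: "'v strategy" where \<sigma>: "\<And>\<iota> A. (\<And>t. \<iota> t \<in> momentary_inputs horn_sig) \<Longrightarrow>
      A \<in> assignments bl horn_sig \<Longrightarrow>
      sat bl horn_sig init A (branch \<sigma> \<iota>) \<iota> 0 (refutation (recf_trm f) n)"
    by (auto simp: realizable_def)
  obtain h :: "nat \<Rightarrow> 'v" where h: "inj h"
    using infinite_countable_subset [OF assms(2)] by blast
  define e :: "standard_value \<Rightarrow> 'v" where "e = h \<circ> to_nat"
  have "inj e"
    unfolding e_def using h by (intro inj_compose) auto
  then have inv_e [simp]: "inv e (e x) = x" for x
    by simp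
  \<comment> \<open>\<open>inv e\<close> gives a reading to every value, also to one outside the
    range of \<open>e\<close>, as an initial value may be.\<close>
  define A :: "'v assignment" where
    "A l vs = (if lit_name l < 8 then e (standard_fun (lit_name l) (map (inv e) vs))
      else bl (standard_pred (lit_name l) (map (inv e) vs)))" for l vs
  have A_Lit: "A (Lit k m) vs = (if k < 8 then e (standard_fun k (map (inv e) vs))
      else bl (standard_pred k (map (inv e) vs)))" for k m vs
    by (simp add: A_def)
  have bl: "bl b = bl True \<longleftrightarrow> b" for b
    using assms(1) by (simp add: inj_eq)
  have A_in: "A \<in> assignments bl horn_sig"
    by (auto simp: assignments_def A_Lit sig_def)
  have clauses: "holds bl A \<rho> c" if "c \<in> set clauses" for \<rho> c
  proof -
    have "\<forall>c\<in>set clauses. holds bl A \<rho> c"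
      by (simp add: clauses_def Let_def holds_def A_Lit bl standard_fun_def standard_pred_def)
        (auto intro: computes.intros computes_Proj simp: less_Suc_eq)
    then show ?thesis using that by blast
  qed
  have num: "num_of (inv e (tval A \<rho> (nat_trm k))) = k" for \<rho> k
    by (induction k) (simp_all add: A_Lit standard_fun_def)
  have progs: "progs_of (inv e (tval A \<rho> (list_trm (map recf_trm gs)))) = gs"
    if "\<And>g. g \<in> set gs \<Longrightarrow> prog_of (inv e (tval A \<rho> (recf_trm g))) = g" for \<rho> gs
    using that by (induction gs) (simp_all add: A_Lit standard_fun_def)
  have prog: "prog_of (inv e (tval A \<rho> (recf_trm g))) = g" for \<rho> g
    by (induction g) (simp_all add: A_Lit standard_fun_def num progs)
  \<comment> \<open>The only momentary input over the empty set of input symbols.\<close>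
  define \<iota> :: "nat \<Rightarrow> 'v momentary_input" where "\<iota> t = (\<lambda>_. undefined)" for t
  have "sat bl horn_sig init A (branch \<sigma> \<iota>) \<iota> 0 (refutation (recf_trm f) n)"
    using A_in by (intro \<sigma>) (simp_all add: \<iota>_def momentary_inputs_def)
  then obtain \<rho> where "tval A \<rho> (query (recf_trm f) n) = bl True"
    using clauses eval_eq_tval by (metis sat_refutation)
  then have "computes f [n] 0"
    using num [of \<rho> n] prog [of \<rho> f]
    by (simp add: query_def A_Lit bl standard_fun_def standard_pred_def)
  with assms(3) show False by simp
qed


section \<open>Computability of the reduction\<close>

definition computable :: "(nat \<Rightarrow> nat) \<Rightarrow> bool" where
  "computable F \<longleftrightarrow> (\<exists>f. \<forall>n. computes f [n] (F n))"

lemma computes_Comp1: "computes g xs y \<Longrightarrow> computes f [y] z \<Longrightarrow> computes (Comp f [g]) xs z"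
  by (rule computes.comp [where ys = "[y]"]) auto

lemma computes_Comp2:
  "computes g xs y \<Longrightarrow> computes g' xs y' \<Longrightarrow> computes f [y, y'] z \<Longrightarrow> computes (Comp f [g, g']) xs z"
  by (rule computes.comp [where ys = "[y, y']"]) auto

fun const_recf :: "nat \<Rightarrow> recf" where
  "const_recf 0 = Zero"
| "const_recf (Suc k) = Comp Succ [const_recf k]"

lemma computes_const: "computes (const_recf k) xs k"
  by (induction k) (auto intro: computes.intros computes_Comp1)

definition add_recf :: recf where
  "add_recf = PRec (Proj 0) (Comp Succ [Proj 1])"

lemma computes_add: "computes add_recf [m, n] (m + n)"
  unfolding add_recf_def
  by (induction m) (auto intro!: computes.prec_0 computes.prec_Suc computes_Comp1 computes_Proj computes.succ)

definition triangle_recf :: recf where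
  "triangle_recf = PRec Zero (Comp add_recf [Proj 1, Comp Succ [Proj 0]])"

lemma computes_triangle: "computes triangle_recf [n] (triangle n)"
proof (induction n)
  case (Suc n)
  then show ?case
    unfolding triangle_recf_def triangle_Suc
    by (intro computes.prec_Suc computes_Comp2 [OF _ _ computes_add] computes_Comp1 [OF _ computes.succ]
        computes_Proj) auto
qed (auto simp: triangle_recf_def intro: computes.prec_0 computes.zero)

lemma computable_const: "computable (\<lambda>_. k)"
  unfolding computable_def using computes_const by blast

lemma computable_id: "computable (\<lambda>n. n)"
  unfolding computable_def by (rule exI [of _ "Proj 0"]) (simp add: computes_Proj)

lemma computable_Suc: "computable F \<Longrightarrow> computable (\<lambda>n. Suc (F n))"
  unfolding computable_def by (meson computes_Comp1 computes.succ)

text \<open>The pair of \<open>a\<close> and \<open>b\<close> has the code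
  \<open>triangle (a + b) + a\<close>.\<close>

lemma computable_prod_encode:
  assumes "computable F" and "computable G"
  shows "computable (\<lambda>n. prod_encode (F n, G n))"
proof -
  from assms obtain f g where f: "\<And>n. computes f [n] (F n)" and g: "\<And>n. computes g [n] (G n)"
    unfolding computable_def by blast
  have "computes (Comp add_recf [Comp triangle_recf [Comp add_recf [f, g]], f]) [n]
      (prod_encode (F n, G n))" for n
    unfolding prod_encode_def prod.case
    by (rule computes_Comp2 computes_Comp1 f g computes_triangle computes_add)+
  then show ?thesis
    unfolding computable_def by blast
qed

lemma computable_funpow:
  assumes "computable G"
  shows "computable (\<lambda>n. (G ^^ n) k)"
proof -
  from assms obtain g where g: "\<And>n. computes g [n] (G n)"
    unfolding computable_def by blast
  have "computes (PRec (const_recf k) (Comp g [Proj 1])) [n] ((G ^^ n) k)" for n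
    by (induction n)
      (auto intro!: computes.prec_0 computes_const computes.prec_Suc computes_Comp1 [OF _ g] computes_Proj)
  then show ?thesis
    unfolding computable_def by blast
qed

lemmas computable_intros =
  computable_const computable_id computable_Suc computable_prod_encode computable_funpow

text \<open>Numerals are unary, so their codes arise by iterating one computable function, as
  \<open>computable_funpow\<close> demands.\<close>

lemma code_nat_trm:
  "code_trm (nat_trm n) =
    ((\<lambda>k. prod_encode (1, prod_encode (code_literal (Lit 1 1), list_encode [k]))) ^^ n) (code_trm null_t)"
  by (induction n) simp_all

text \<open>The formula varies only in the term \<open>u\<close>, whose code is the argument of
  \<open>r\<close> itself, and in the numeral of that code. Hence \<open>r\<close> need not decode
  anything.\<close>

lemma computable_reduction:
  "\<exists>r. computable r \<and> (\<forall>u. r (code_trm u) =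
    code_instance (horn_sig, refutation u (code_trm u)))"
proof -
  define C where "C = code_tsl (conj_tsl (map clause_tsl clauses))"
  define T where "T = code_tsl top_tsl"
  define r where "r n =
    prod_encode (code_signature horn_sig, prod_encode (5, prod_encode (T, prod_encode (2, prod_encode (3,
      prod_encode (C, prod_encode (2, prod_encode (0, prod_encode (1, prod_encode (code_literal (Lit 8 3),
        list_encode [n, prod_encode (1, prod_encode (code_literal (Lit 2 2),
          list_encode [code_trm (nat_trm n), code_trm null_t])), code_trm null_t]))))))))))" for n
  have "computable r"
    unfolding r_def list_encode.simps code_nat_trm by (intro computable_intros)
  moreover have "r (code_trm u) = code_instance (horn_sig, refutation u (code_trm u))" for u
    by (simp add: r_def code_instance_def refutation_def query_def C_def T_def)
  ultimately show ?thesis by blast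
qed

section \<open>The diagonal argument\<close>

theorem theorem2:
  fixes bl :: "bool \<Rightarrow> 'v" and init :: "symbol \<Rightarrow> 'v"
  assumes "inj bl" and "infinite (UNIV :: 'v set)"
  shows "\<not> decidable_problem code_instance tsl_instances (realizable bl init)"
proof
  assume "decidable_problem code_instance tsl_instances (realizable bl init)"
  then obtain f where f: "\<And>x. x \<in> tsl_instances \<Longrightarrow>
      computes f [code_instance x] (if realizable bl init x then 1 else 0)"
    unfolding decidable_problem_def by blast
  obtain r g where g: "\<And>n. computes g [n] (r n)"
    and r: "\<And>u. r (code_trm u) = code_instance (horn_sig, refutation u (code_trm u))"
    using computable_reduction unfolding computable_def by blast
  define d where "d = Comp f [g]"
  \<comment> \<open>On its own number \<open>n\<close>, the program \<open>d\<close> returns the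
    decision about the formula claiming that \<open>d\<close> yields 0 on \<open>n\<close>.\<close>
  define n where "n = code_trm (recf_trm d)"
  let ?x = "(horn_sig, refutation (recf_trm d) n)"
  have d: "computes d [n] (if realizable bl init ?x then 1 else 0)"
    using computes_Comp1 [OF g, of f n] f [OF refutation_instance, of d n] r [of "recf_trm d"]
    by (simp add: d_def n_def)
  \<comment> \<open>If realizable, \<open>d\<close> yields both 1 and 0 on \<open>n\<close>; if not,
    it yields 0, which makes the formula realizable.\<close>
  have "realizable bl init ?x \<longleftrightarrow> computes d [n] 0"
    using realizable_refutation unrealizable_refutation [OF assms] by blast
  with d show False
    using computes_functional [OF d] by (auto split: if_splits)
qed

end
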